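(* Let $(X_n)_{n\ge 0}$ be a positive Harris recurrent Markov chain on $\mathbb{R}^d$ and let $\mu$ denote its unique stationary probability measure. Let $A,B\subseteq\mathbb{R}^d$ be measurable sets such that $\mu(A)\in(0,1)$. Let $\alpha_A:=\mathbb{P}_\mu(X_0\notin A,\,X_1\in A)$, let $L_1$ be the length of the first recurrency cycle, $R_1$ the time spent in $B$ during the first recurrency cycle, and let $T_B:=\mathbb{E}[R_1]$, where the expectations $\mathbb{E}[R_1]$ and $\mathbb{E}[L_1]$ are taken in the cycle-stationary regime (all as defined in the context). Then $\mathbb{E}[L_1]<\infty$, $$\mu(B)=\alpha_A\cdot T_B,$$ and $\alpha_A=(\mathbb{E}[L_1])^{-1}$.
   Context: $(X_n)_{n\ge0}$ is a discrete-time, time-homogeneous Markov chain with state space $\mathbb{R}^d$ (Borel $\sigma$-algebra) and transition kernel $P(x,\mathrm{d}y)$; a stationary probability measure satisfies $\mu(C)=\int\mu(\mathrm{d}x)P(x,C)$ for all measurable $C$. "Positive Harris recurrent" has its standard meaning (Harris recurrent and admitting an invariant probability measure, which is then unique). $\mathbb{P}_\mu$ denotes the law of the chain with $X_0\sim\mu$. Inward crossing times of $A$: $S_{-1}:=0$ and, for $k\ge0$, $S_k:=\inf\{n>S_{k-1}: X_{n-1}\notin A,\ X_n\in A\}$. The cycle length of the $k$-th recurrency cycle is $L_k:=S_k-S_{k-1}$, and the time spent in $B$ within the $k$-th cycle is $R_k:=\sum_{n=S_{k-1}}^{S_k-1}\mathbf{1}\{X_n\in B\}$. In particular $L_1=S_1-S_0$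 and $R_1=\sum_{n=S_0}^{S_1-1}\mathbf{1}\{X_n\in B\}$. Cycle-stationary regime: $X_0\sim\mu$ conditioned on $S_0=1$, i.e. conditioned on the event $\{X_0\notin A,\ X_1\in A\}$. Thus $\mathbb{E}[\,\cdot\,]=\mathbb{E}_\mu[\,\cdot\mid X_0\notin A,\ X_1\in A]$ for the expectations of $L_1$ and $R_1$. *)

theory Defs
  imports "HOL-Probability.Probability"
begin

section \<open>Markov chains on the canonical path space\<close>

definition transition_kernel :: "('a::topological_space \<Rightarrow> 'a measure) \<Rightarrow> bool" where
  "transition_kernel P \<longleftrightarrow> P \<in> borel \<rightarrow>\<^sub>M prob_algebra borel"

definition stationary :: "('a::topological_space \<Rightarrow> 'a measure) \<Rightarrow> 'a measure \<Rightarrow> bool" where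
  "stationary P \<mu> \<longleftrightarrow> prob_space \<mu> \<and> sets \<mu> = sets borel \<and>
     (\<forall>C\<in>sets borel. emeasure \<mu> C = (\<integral>\<^sup>+x. emeasure (P x) C \<partial>\<mu>))"

definition chain_step ::
  "('a \<Rightarrow> 'a measure) \<Rightarrow> 'a measure \<Rightarrow> nat \<Rightarrow> (nat \<Rightarrow> 'a) \<Rightarrow> 'a measure" where
  "chain_step P \<nu> n \<omega> = (case n of 0 \<Rightarrow> \<nu> | Suc m \<Rightarrow> P (\<omega> m))"

text \<open>The law of \<open>(X\<^sub>n)\<close> with transition kernel \<open>P\<close> and \<open>X\<^sub>0 \<sim> \<nu>\<close>, as a measure on sequences; the chain
  itself is the coordinate process \<open>X\<^sub>n(\<omega>) = \<omega> n\<close>. It is the measure provided by the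
  Ionescu-Tulcea theorem; the lemmas below show that it is the intended one.\<close>

definition chain_law ::
  "('a::topological_space \<Rightarrow> 'a measure) \<Rightarrow> 'a measure \<Rightarrow> (nat \<Rightarrow> 'a) measure" where
  "chain_law P \<nu> =
     projective_family.lim UNIV (Ionescu_Tulcea.CI (chain_step P \<nu>) (\<lambda>_. borel)) (\<lambda>_. borel)"

lemma Ionescu_Tulcea_chain_step:
  fixes P :: "'a::topological_space \<Rightarrow> 'a measure"
  assumes P: "transition_kernel P" and \<nu>: "prob_space \<nu>" "sets \<nu> = sets borel"
  shows "Ionescu_Tulcea (chain_step P \<nu>) (\<lambda>_. borel)"
proof (rule Ionescu_Tulcea.intro)
  have [measurable]: "P \<in> borel \<rightarrow>\<^sub>M subprob_algebra borel"
    using P unfolding transition_kernel_def by (rule measurable_prob_algebraD)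
  have \<nu>': "\<nu> \<in> space (subprob_algebra borel)"
    using \<nu> by (simp add: space_subprob_algebra prob_space_imp_subprob_space)
  show "chain_step P \<nu> i \<in> measurable (PiM {0..<i} (\<lambda>_. borel)) (subprob_algebra borel)" for i
    using \<nu>' by (cases i) (simp_all add: chain_step_def[abs_def])
  show "prob_space (chain_step P \<nu> i x)" for i x
    using \<nu>(1) P
    by (cases i) (auto simp: chain_step_def transition_kernel_def space_prob_algebra
        dest: measurable_space)
qed

context
  fixes P :: "'a::topological_space \<Rightarrow> 'a measure" and \<nu> :: "'a measure"
  assumes P: "transition_kernel P" and \<nu>: "prob_space \<nu>" "sets \<nu> = sets borel"
begin

interpretation IT: Ionescu_Tulcea "chain_step P \<nu>" "\<lambda>_. borel"
  using P \<nu> by (rule Ionescu_Tulcea_chain_step)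

lemma sets_chain_law: "sets (chain_law P \<nu>) = sets (PiM UNIV (\<lambda>_. borel))"
  unfolding chain_law_def by (rule IT.PF.sets_lim)

lemma chain_law_prefix:
  "distr (chain_law P \<nu>) (PiM {0..<n} (\<lambda>_. borel)) (\<lambda>\<omega>. restrict \<omega> {0..<n})
     = IT.C 0 n (\<lambda>_. undefined)"
proof -
  have "IT.CI {0..<n} = IT.C 0 n (\<lambda>_. undefined)"
  proof -
    have u: "IT.up_to {0..<n} \<le> n" by (simp add: IT.up_to_iff)
    moreover have "n \<le> IT.up_to {0..<n}"
      using IT.up_to_less[of "{0..<n}" "n - 1"] by (cases n) auto
    ultimately have "IT.up_to {0..<n} = n" by simp
    then show ?thesis
      using IT.distr_C[of n n "\<lambda>_. undefined" 0] by (simp add: IT.CI_def space_PiM)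
  qed
  then show ?thesis
    unfolding chain_law_def using IT.distr_lim[of "{0..<n}"] by simp
qed

lemma prob_space_chain_law: "prob_space (chain_law P \<nu>)"
proof (rule prob_space_distrD)
  show "(\<lambda>\<omega>. restrict \<omega> {0..<0}) \<in> chain_law P \<nu> \<rightarrow>\<^sub>M PiM {0..<0} (\<lambda>_. borel)"
    unfolding measurable_cong_sets[OF sets_chain_law refl]
    by (rule measurable_restrict_subset) simp
  show "prob_space (distr (chain_law P \<nu>) (PiM {0..<0} (\<lambda>_. borel)) (\<lambda>\<omega>. restrict \<omega> {0..<0}))"
    unfolding chain_law_prefix by (rule IT.prob_space_C) (simp add: space_PiM)
qed

lemma chain_law_initial:
  "distr (chain_law P \<nu>) (PiM {0..<1} (\<lambda>_. borel)) (\<lambda>\<omega>. restrict \<omega> {0..<1})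
     = distr \<nu> (PiM {0..<1} (\<lambda>_. borel)) (fun_upd (\<lambda>_. undefined) 0)"
  unfolding chain_law_prefix
  by (simp add: IT.eP_def chain_step_def space_PiM
      bind_return[OF IT.measurable_eP[of 0, simplified]])

lemma chain_law_Markov:
  "distr (chain_law P \<nu>) (PiM {0..<Suc (Suc n)} (\<lambda>_. borel)) (\<lambda>\<omega>. restrict \<omega> {0..<Suc (Suc n)})
     = distr (chain_law P \<nu>) (PiM {0..<Suc n} (\<lambda>_. borel)) (\<lambda>\<omega>. restrict \<omega> {0..<Suc n})
       \<bind> (\<lambda>\<omega>. distr (P (\<omega> n)) (PiM {0..<Suc (Suc n)} (\<lambda>_. borel)) (fun_upd \<omega> (Suc n)))"
proof -
  have "IT.eP (Suc n) = (\<lambda>\<omega>. distr (P (\<omega> n)) (PiM {0..<Suc (Suc n)} (\<lambda>_. borel)) (fun_upd \<omega> (Suc n)))"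
    by (rule ext) (simp add: IT.eP_def chain_step_def)
  then show ?thesis
    unfolding chain_law_prefix IT.C.simps(2)[of 0 "Suc n"] by simp
qed

end

section \<open>Harris recurrence\<close>

definition Harris_recurrent :: "('a::topological_space \<Rightarrow> 'a measure) \<Rightarrow> bool" where
  "Harris_recurrent P \<longleftrightarrow>
     (\<exists>\<phi>. sigma_finite_measure \<phi> \<and> sets \<phi> = sets borel \<and> emeasure \<phi> (space \<phi>) \<noteq> 0 \<and>
       (\<forall>C\<in>sets borel. emeasure \<phi> C > 0 \<longrightarrow>
          (\<forall>x. AE \<omega> in chain_law P (return borel x). \<exists>\<^sub>\<infinity>n. \<omega> n \<in> C)))"

definition positive_Harris_recurrent :: "('a::topological_space \<Rightarrow> 'a measure) \<Rightarrow> bool" where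
  "positive_Harris_recurrent P \<longleftrightarrow> Harris_recurrent P \<and> (\<exists>\<mu>. stationary P \<mu>)"

section \<open>Recurrency cycles\<close>

text \<open>\<open>cycle_start A \<omega> k\<close> is \<open>S\<^bsub>k-1\<^esub>\<close>, so that the initial value \<open>S\<^bsub>-1\<^esub> = 0\<close> has index \<open>0\<close>. The infimum
  of the empty set is \<open>\<infinity>\<close>.\<close>

primrec cycle_start :: "'a set \<Rightarrow> (nat \<Rightarrow> 'a) \<Rightarrow> nat \<Rightarrow> enat" where
  "cycle_start A \<omega> 0 = 0"
| "cycle_start A \<omega> (Suc k) =
     Inf {enat n |n. enat n > cycle_start A \<omega> k \<and> \<omega> (n - 1) \<notin> A \<and> \<omega> n \<in> A}"

definition crossing_time :: "'a set \<Rightarrow> (nat \<Rightarrow> 'a) \<Rightarrow> nat \<Rightarrow> enat" where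
  "crossing_time A \<omega> k = cycle_start A \<omega> (Suc k)"

definition cycle_length :: "'a set \<Rightarrow> (nat \<Rightarrow> 'a) \<Rightarrow> nat \<Rightarrow> enat" where
  "cycle_length A \<omega> k = crossing_time A \<omega> k - cycle_start A \<omega> k"

definition cycle_occupation :: "'a set \<Rightarrow> 'a set \<Rightarrow> (nat \<Rightarrow> 'a) \<Rightarrow> nat \<Rightarrow> ennreal" where
  "cycle_occupation A B \<omega> k =
     (\<Sum>n. if cycle_start A \<omega> k \<le> enat n \<and> enat n < crossing_time A \<omega> k
           then indicator B (\<omega> n) else 0)"

definition crossing_event :: "'a set \<Rightarrow> (nat \<Rightarrow> 'a) set" where
  "crossing_event A = {\<omega>. \<omega> 0 \<notin> A \<and> \<omega> 1 \<in> A}"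

definition crossing_prob ::
  "('a::topological_space \<Rightarrow> 'a measure) \<Rightarrow> 'a measure \<Rightarrow> 'a set \<Rightarrow> ennreal" where
  "crossing_prob P \<mu> A = emeasure (chain_law P \<mu>) (crossing_event A)"

text \<open>\<^const>\<open>uniform_measure\<close> \<open>M E\<close> is the conditional law \<open>M(\<cdot> | E)\<close>.\<close>

definition cycle_stationary_law ::
  "('a::topological_space \<Rightarrow> 'a measure) \<Rightarrow> 'a measure \<Rightarrow> 'a set \<Rightarrow> (nat \<Rightarrow> 'a) measure" where
  "cycle_stationary_law P \<mu> A = uniform_measure (chain_law P \<mu>) (crossing_event A)"

definition mean_cycle_length ::
  "('a::topological_space \<Rightarrow> 'a measure) \<Rightarrow> 'a measure \<Rightarrow> 'a set \<Rightarrow> ennreal" where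
  "mean_cycle_length P \<mu> A =
     (\<integral>\<^sup>+\<omega>. ennreal_of_enat (cycle_length A \<omega> 1) \<partial>cycle_stationary_law P \<mu> A)"

definition mean_cycle_occupation ::
  "('a::topological_space \<Rightarrow> 'a measure) \<Rightarrow> 'a measure \<Rightarrow> 'a set \<Rightarrow> 'a set \<Rightarrow> ennreal" where
  "mean_cycle_occupation P \<mu> A B =
     (\<integral>\<^sup>+\<omega>. cycle_occupation A B \<omega> 1 \<partial>cycle_stationary_law P \<mu> A)"

end

theory Submission
  imports Defs
begin

text \<open>Write \<open>M\<close> for the law of the stationary chain and say that the path \<open>\<omega>\<close> crosses at \<open>k\<close> if
\<open>\<omega> k \<notin> A\<close> and \<open>\<omega> (k + 1) \<in> A\<close>. Conditionally on a crossing at \<open>0\<close> the first cycle begins at time \<open>1\<close>,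
and time \<open>j + 1\<close> belongs to it precisely if there is no crossing at \<open>1, \<dots>, j\<close>. Hence
\<open>\<alpha>\<^sub>A T\<^sub>B\<close> is the sum over \<open>j\<close> of
\<open>M(crossing at 0, none at 1, \<dots>, j, X\<^bsub>j+1\<^esub> \<in> B)\<close>.

Put \<open>u\<^sub>j = M(no crossing at 0, \<dots>, j - 1, X\<^sub>j \<in> B)\<close>. By shift invariance of \<open>M\<close>, \<open>u\<^sub>j\<close> is also
the probability of no crossing at \<open>1, \<dots>, j\<close> and \<open>X\<^bsub>j+1\<^esub> \<in> B\<close>. Splitting this event according to
whether there is a crossing at \<open>0\<close> shows that the \<open>j\<close>-th summand above equals \<open>u\<^sub>j - u\<^bsub>j+1\<^esub>\<close>
(\<open>cycle_visit_telescope\<close>). The series therefore telescopes to \<open>u\<^sub>0 = \<mu>(B)\<close>, provided that \<open>u\<^sub>j\<close>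
tends to \<open>0\<close>. For \<open>B = UNIV\<close> the occupation time is the cycle length, so that \<open>\<alpha>\<^sub>A E[L\<^sub>1] = 1\<close>;
this also yields that \<open>E[L\<^sub>1]\<close> is finite.

It remains to see that \<open>M\<close>-almost every path crosses (\<open>AE_crosses\<close>). A path that visits the
complement of \<open>A\<close> and afterwards visits \<open>A\<close> has to cross, so by shift invariance it suffices that
almost surely the chain neither stays in \<open>A\<close> forever nor in its complement (\<open>AE_leaves\<close>). Here
Harris recurrence enters. The reference measure \<open>\<phi>\<close> of Harris recurrence need not charge \<open>A\<close>,
so recurrence is not applied to \<open>A\<close> itself. Let \<open>g(x)\<close> be the probability of staying in \<open>A\<close> forever
when starting at \<open>x\<close>, and let \<open>F = {g > 0}\<close>, a subset of \<open>A\<close>. Staying forever is preserved by the shift, which gives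
\<open>g \<le> P g\<close>; both sides have the same \<open>\<mu>\<close>-integral, so \<open>g = P g\<close> almost everywhere and the complement of
\<open>F\<close> is absorbing up to a null set. A stationary chain cannot flow from \<open>F\<close> into its complement
without flowing back, so the whole trajectory lies in \<open>F\<close> or in its complement according to its
starting point (\<open>absorbing_AE_invariant\<close>). Since \<open>\<phi>\<close> charges \<open>F\<close> or its complement, that
set is visited from everywhere, and so it carries all of \<open>\<mu>\<close>. It cannot be \<open>F\<close>, as \<open>\<mu>(A) < 1\<close>;
hence \<open>\<mu>(F) = 0\<close>, that is, \<open>g = 0\<close> almost everywhere.

The shift invariance of \<open>M\<close> and the representation of the law with a given initial distribution as
a mixture of the laws started at points are obtained from an explicit formula for the
probability of finite-dimensional boxes (\<open>emeasure_chain_law_box\<close>).\<close>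

section \<open>Finite-dimensional distributions of the chain\<close>

lemma kernel_measurable:
  fixes P :: "'a::topological_space \<Rightarrow> 'a measure"
  assumes "transition_kernel P"
  shows "P \<in> borel \<rightarrow>\<^sub>M subprob_algebra borel"
  using assms unfolding transition_kernel_def by (rule measurable_prob_algebraD)

lemma kernel_prob_space:
  fixes P :: "'a::topological_space \<Rightarrow> 'a measure"
  assumes "transition_kernel P"
  shows "prob_space (P x)" "sets (P x) = sets borel"
proof -
  have "P x \<in> space (prob_algebra borel)"
    using assms unfolding transition_kernel_def by (rule measurable_space) simp
  then show "prob_space (P x)" "sets (P x) = sets borel"
    by (simp_all add: space_prob_algebra)
qed

lemma space_chain_law:
  fixes P :: "'a::topological_space \<Rightarrow> 'a measure"
  assumes "transition_kernel P" "prob_space \<nu>" "sets \<nu> = sets borel"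
  shows "space (chain_law P \<nu>) = UNIV"
  using sets_eq_imp_space_eq[OF sets_chain_law[OF assms]] by (simp add: space_PiM)

lemma chain_law_integral_initial:
  fixes P :: "'a::topological_space \<Rightarrow> 'a measure"
  assumes P: "transition_kernel P" and \<nu>: "prob_space \<nu>" "sets \<nu> = sets borel"
    and [measurable]: "f \<in> borel_measurable borel"
  shows "(\<integral>\<^sup>+\<omega>. f (\<omega> 0) \<partial>chain_law P \<nu>) = (\<integral>\<^sup>+x. f x \<partial>\<nu>)"
proof -
  note [measurable_cong] = sets_chain_law[OF P \<nu>] \<nu>(2)
  let ?R = "PiM {0..<1::nat} (\<lambda>_. borel :: 'a measure)"
  have [measurable]: "(\<lambda>\<omega>. f (\<omega> 0)) \<in> borel_measurable ?R"
    by (rule measurable_compose[OF measurable_component_singleton]) auto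
  have [measurable]: "(\<lambda>\<omega>. restrict \<omega> {0..<1}) \<in> chain_law P \<nu> \<rightarrow>\<^sub>M ?R"
    unfolding measurable_cong_sets[OF sets_chain_law[OF P \<nu>] refl]
    by (rule measurable_restrict_subset) simp
  have upd: "fun_upd (\<lambda>_. undefined) 0 \<in> \<nu> \<rightarrow>\<^sub>M ?R"
    unfolding measurable_cong_sets[OF \<nu>(2) refl]
    by (rule measurable_fun_upd[where J="{}"]) (auto simp: space_PiM)
  have "(\<integral>\<^sup>+\<omega>. f (\<omega> 0) \<partial>chain_law P \<nu>)
      = (\<integral>\<^sup>+\<omega>. f (\<omega> 0) \<partial>distr (chain_law P \<nu>) ?R (\<lambda>\<omega>. restrict \<omega> {0..<1}))"
    by (subst nn_integral_distr) simp_all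
  also have "\<dots> = (\<integral>\<^sup>+\<omega>. f (\<omega> 0) \<partial>distr \<nu> ?R (fun_upd (\<lambda>_. undefined) 0))"
    by (simp only: chain_law_initial[OF P \<nu>])
  also have "\<dots> = (\<integral>\<^sup>+x. f x \<partial>\<nu>)"
    using upd by (subst nn_integral_distr) simp_all
  finally show ?thesis .
qed

text \<open>The Markov property in the form in which it is used: the last coordinate is integrated out
against the kernel. The factors in front are restricted to indicators of the earlier coordinates, which is
all that the induction over the length of a box requires.\<close>

lemma chain_law_integral_Suc:
  fixes P :: "'a::topological_space \<Rightarrow> 'a measure"
  assumes P: "transition_kernel P" and \<nu>: "prob_space \<nu>" "sets \<nu> = sets borel"
    and C: "\<And>i. C i \<in> sets borel"
    and f: "f \<in> borel_measurable borel"
  shows "(\<integral>\<^sup>+\<omega>. (\<Prod>i\<le>n. indicator (C i) (\<omega> i)) * f (\<omega> (Suc n)) \<partial>chain_law P \<nu>)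
       = (\<integral>\<^sup>+\<omega>. (\<Prod>i\<le>n. indicator (C i) (\<omega> i)) * (\<integral>\<^sup>+y. f y \<partial>P (\<omega> n)) \<partial>chain_law P \<nu>)"
proof -
  interpret IT: Ionescu_Tulcea "chain_step P \<nu>" "\<lambda>_. borel"
    using P \<nu> by (rule Ionescu_Tulcea_chain_step)
  note C[measurable] f[measurable] kernel_measurable[OF P, measurable]
  note [measurable_cong] = sets_chain_law[OF P \<nu>]
  let ?R = "\<lambda>n::nat. PiM {0..<n} (\<lambda>_. borel :: 'a measure)"
  have [measurable]: "(\<lambda>\<omega>. restrict \<omega> {0..<m}) \<in> chain_law P \<nu> \<rightarrow>\<^sub>M ?R m" for m
    unfolding measurable_cong_sets[OF sets_chain_law[OF P \<nu>] refl]
    by (rule measurable_restrict_subset) simp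
  have comp[measurable]: "(\<lambda>\<omega>. \<omega> i) \<in> ?R m \<rightarrow>\<^sub>M borel" if "i < m" for i m
    using that by (intro measurable_component_singleton) simp
  let ?F = "\<lambda>\<omega>. (\<Prod>i\<le>n. indicator (C i) (\<omega> i)) * f (\<omega> (Suc n)) :: ennreal"
  have F[measurable]: "?F \<in> borel_measurable (?R (Suc (Suc n)))"
    by measurable auto
  have [measurable]: "(\<lambda>x. \<integral>\<^sup>+ y. f y \<partial>P x) \<in> borel_measurable borel"
    by (rule measurable_compose[OF kernel_measurable[OF P]])
      (rule nn_integral_measurable_subprob_algebra[OF f])
  have G[measurable]: "(\<lambda>\<omega>. (\<Prod>i\<le>n. indicator (C i) (\<omega> i)) * (\<integral>\<^sup>+y. f y \<partial>P (\<omega> n)) :: ennreal)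
      \<in> borel_measurable (?R (Suc n))"
    by measurable auto
  have eP: "IT.eP (Suc n) = (\<lambda>\<omega>. distr (P (\<omega> n)) (?R (Suc (Suc n))) (fun_upd \<omega> (Suc n)))"
    by (rule ext) (simp add: IT.eP_def chain_step_def)
  have "(\<integral>\<^sup>+\<omega>. ?F \<omega> \<partial>chain_law P \<nu>)
      = (\<integral>\<^sup>+\<omega>. ?F \<omega> \<partial>distr (chain_law P \<nu>) (?R (Suc (Suc n))) (\<lambda>\<omega>. restrict \<omega> {0..<Suc (Suc n)}))"
    by (subst nn_integral_distr) (auto intro!: nn_integral_cong prod.cong)
  also have "\<dots> = (\<integral>\<^sup>+\<omega>. (\<integral>\<^sup>+\<omega>'. ?F \<omega>' \<partial>IT.eP (Suc n) \<omega>)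
      \<partial>distr (chain_law P \<nu>) (?R (Suc n)) (\<lambda>\<omega>. restrict \<omega> {0..<Suc n}))"
    unfolding chain_law_Markov[OF P \<nu>] eP[symmetric]
    by (rule nn_integral_bind[OF F]) (simp add: IT.measurable_eP cong: measurable_cong_sets)
  also have "\<dots> = (\<integral>\<^sup>+\<omega>. (\<Prod>i\<le>n. indicator (C i) (\<omega> i)) * (\<integral>\<^sup>+y. f y \<partial>P (\<omega> n))
      \<partial>distr (chain_law P \<nu>) (?R (Suc n)) (\<lambda>\<omega>. restrict \<omega> {0..<Suc n}))"
  proof (rule nn_integral_cong, goal_cases)
    case (1 \<omega>)
    then have \<omega>: "\<omega> \<in> space (?R (Suc n))" by simp
    have "(\<integral>\<^sup>+\<omega>'. ?F \<omega>' \<partial>IT.eP (Suc n) \<omega>)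
        = (\<integral>\<^sup>+y. (\<Prod>i\<le>n. indicator (C i) (\<omega> i)) * f y \<partial>P (\<omega> n))"
      unfolding IT.nn_integral_eP[OF \<omega> F] by (simp add: chain_step_def)
    also have "\<dots> = (\<Prod>i\<le>n. indicator (C i) (\<omega> i)) * (\<integral>\<^sup>+y. f y \<partial>P (\<omega> n))"
      using f kernel_prob_space(2)[OF P]
      by (intro nn_integral_cmult) (simp cong: measurable_cong_sets)
    finally show ?case .
  qed
  also have "\<dots> = (\<integral>\<^sup>+\<omega>. (\<Prod>i\<le>n. indicator (C i) (\<omega> i)) * (\<integral>\<^sup>+y. f y \<partial>P (\<omega> n)) \<partial>chain_law P \<nu>)"
    by (subst nn_integral_distr) (auto intro!: nn_integral_cong prod.cong arg_cong2[where f="(*)"])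
  finally show ?thesis .
qed

text \<open>The iterated kernel integral
\<open>E\<^sub>x[1\<^bsub>C 0\<^esub>(X\<^sub>0) \<cdots> 1\<^bsub>C (n-1)\<^esub>(X\<^bsub>n-1\<^esub>) f(X\<^sub>n)]\<close>, with the recursion on the first step, so that its
dependence on the starting point, and the effect of a shift by one, can be read off.\<close>

primrec box_integral ::
  "('a \<Rightarrow> 'a measure) \<Rightarrow> nat \<Rightarrow> (nat \<Rightarrow> 'a set) \<Rightarrow> ('a \<Rightarrow> ennreal) \<Rightarrow> 'a \<Rightarrow> ennreal" where
  "box_integral P 0 C f x = f x"
| "box_integral P (Suc n) C f x =
     indicator (C 0) x * (\<integral>\<^sup>+y. box_integral P n (\<lambda>i. C (Suc i)) f y \<partial>P x)"

lemma box_integral_measurable: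
  fixes P :: "'a::topological_space \<Rightarrow> 'a measure"
  assumes P: "transition_kernel P" and f: "f \<in> borel_measurable borel"
    and C: "\<And>i. C i \<in> sets borel"
  shows "box_integral P n C f \<in> borel_measurable borel"
  using C
proof (induction n arbitrary: C)
  case 0
  then show ?case using f by (simp cong: measurable_cong)
next
  case (Suc n)
  note Suc.prems[measurable]
  have [measurable]: "(\<lambda>x. \<integral>\<^sup>+y. box_integral P n (\<lambda>i. C (Suc i)) f y \<partial>P x) \<in> borel_measurable borel"
    by (rule measurable_compose[OF kernel_measurable[OF P]])
      (rule nn_integral_measurable_subprob_algebra, rule Suc.IH, rule Suc.prems)
  show ?case by (simp cong: measurable_cong)
qed

text \<open>The recursion on the last step. The path law is built forwards in time, whereas
\<^const>\<open>box_integral\<close> recurses on the first step; this identity mediates between the two.\<close>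

lemma box_integral_Suc':
  "box_integral P (Suc n) C f = box_integral P n C (\<lambda>x. indicator (C n) x * (\<integral>\<^sup>+y. f y \<partial>P x))"
proof (induction n arbitrary: C)
  case 0
  show ?case by (rule ext) (simp only: box_integral.simps)
next
  case (Suc n)
  show ?case
    by (rule ext) (simp only: box_integral.simps(2)[of _ "Suc n"] Suc.IH box_integral.simps(2)[of _ n])
qed

lemma chain_law_box_integral:
  fixes P :: "'a::topological_space \<Rightarrow> 'a measure"
  assumes P: "transition_kernel P" and \<nu>: "prob_space \<nu>" "sets \<nu> = sets borel"
    and C: "\<And>i. C i \<in> sets borel"
    and f: "f \<in> borel_measurable borel"
  shows "(\<integral>\<^sup>+\<omega>. (\<Prod>i<n. indicator (C i) (\<omega> i)) * f (\<omega> n) \<partial>chain_law P \<nu>)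
       = (\<integral>\<^sup>+x. box_integral P n C f x \<partial>\<nu>)"
  using f
proof (induction n arbitrary: f)
  case 0
  then show ?case by (simp add: chain_law_integral_initial[OF P \<nu>])
next
  case (Suc n)
  note C[measurable]
  have [measurable]: "(\<lambda>x. \<integral>\<^sup>+ y. f y \<partial>P x) \<in> borel_measurable borel"
    by (rule measurable_compose[OF kernel_measurable[OF P]])
      (rule nn_integral_measurable_subprob_algebra[OF Suc.prems])
  have "(\<integral>\<^sup>+\<omega>. (\<Prod>i<Suc n. indicator (C i) (\<omega> i)) * f (\<omega> (Suc n)) \<partial>chain_law P \<nu>)
      = (\<integral>\<^sup>+\<omega>. (\<Prod>i<Suc n. indicator (C i) (\<omega> i)) * (\<integral>\<^sup>+y. f y \<partial>P (\<omega> n)) \<partial>chain_law P \<nu>)"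
    unfolding lessThan_Suc_atMost by (rule chain_law_integral_Suc[OF P \<nu> C Suc.prems])
  also have "\<dots> = (\<integral>\<^sup>+\<omega>. (\<Prod>i<n. indicator (C i) (\<omega> i)) *
      (indicator (C n) (\<omega> n) * (\<integral>\<^sup>+y. f y \<partial>P (\<omega> n))) \<partial>chain_law P \<nu>)"
    by (simp only: prod.lessThan_Suc mult.assoc)
  also have "\<dots> = (\<integral>\<^sup>+x. box_integral P n C (\<lambda>x. indicator (C n) x * (\<integral>\<^sup>+y. f y \<partial>P x)) x \<partial>\<nu>)"
    by (rule Suc.IH) measurable
  finally show ?case
    by (simp only: box_integral_Suc')
qed

lemma emeasure_chain_law_box:
  fixes P :: "'a::topological_space \<Rightarrow> 'a measure"
  assumes P: "transition_kernel P" and \<nu>: "prob_space \<nu>" "sets \<nu> = sets borel"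
    and C: "\<And>i. C i \<in> sets borel"
  shows "emeasure (chain_law P \<nu>) {\<omega>. \<forall>i<n. \<omega> i \<in> C i} = (\<integral>\<^sup>+x. box_integral P n C (\<lambda>_. 1) x \<partial>\<nu>)"
proof -
  note C[measurable]
  note [measurable_cong] = sets_chain_law[OF P \<nu>]
  note sp[simp] = space_chain_law[OF P \<nu>]
  have box: "{\<omega>. \<forall>i<n. \<omega> i \<in> C i} \<in> sets (chain_law P \<nu>)"
  proof -
    have "{\<omega> \<in> space (chain_law P \<nu>). \<forall>i\<in>{..<n}. \<omega> i \<in> C i} \<in> sets (chain_law P \<nu>)"
      by measurable
    then show ?thesis by (simp add: Ball_def)
  qed
  have ind: "(indicator {\<omega>. \<forall>i<n. \<omega> i \<in> C i} \<omega> :: ennreal) = (\<Prod>i<n. indicator (C i) (\<omega> i))" for \<omega>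
    by (induction n) (auto simp: less_Suc_eq split: split_indicator)
  have "emeasure (chain_law P \<nu>) {\<omega>. \<forall>i<n. \<omega> i \<in> C i}
      = (\<integral>\<^sup>+\<omega>. (\<Prod>i<n. indicator (C i) (\<omega> i)) * 1 \<partial>chain_law P \<nu>)"
    unfolding nn_integral_indicator[OF box, symmetric] mult_1_right
    by (rule nn_integral_cong) (rule ind)
  also have "\<dots> = (\<integral>\<^sup>+x. box_integral P n C (\<lambda>_. 1) x \<partial>\<nu>)"
    by (rule chain_law_box_integral[OF P \<nu> C]) auto
  finally show ?thesis .
qed

section \<open>The law of the chain as a mixture, and its shift\<close>

lemma prod_algebra_nat_box:
  fixes X :: "(nat \<Rightarrow> 'a::topological_space) set"
  assumes "X \<in> prod_algebra UNIV (\<lambda>_. borel)"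
  obtains n C where "\<And>i. C i \<in> sets borel" "X = {\<omega>. \<forall>i<n. \<omega> i \<in> C i}"
proof -
  obtain J E where X: "X = prod_emb UNIV (\<lambda>_. borel) J (\<Pi>\<^sub>E j\<in>J. E j)"
    and J: "finite J" "\<And>j. j \<in> J \<Longrightarrow> E j \<in> sets borel"
    using assms by (rule prod_algebraE) auto
  obtain n where n: "J \<subseteq> {..<n}"
    using J(1) finite_nat_iff_bounded by auto
  show ?thesis
  proof (rule that[of "\<lambda>i. if i \<in> J then E i else UNIV" n])
    show "X = {\<omega>. \<forall>i<n. \<omega> i \<in> (if i \<in> J then E i else UNIV)}"
      unfolding X using n by (subst prod_emb_Pi) (auto simp: J PiE_iff split: if_splits)
  qed (use J in auto)
qed

text \<open>Boxes form an intersection-stable generator of the product sigma-algebra, so finite measures on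
path space are determined by them.\<close>

lemma measure_eqI_boxes:
  fixes M N :: "(nat \<Rightarrow> 'a::topological_space) measure"
  assumes "sets M = sets (PiM UNIV (\<lambda>_. borel))" "sets N = sets (PiM UNIV (\<lambda>_. borel))"
    and "finite_measure M"
    and eq: "\<And>n C. (\<And>i. C i \<in> sets borel) \<Longrightarrow>
      emeasure M {\<omega>. \<forall>i<n. \<omega> i \<in> C i} = emeasure N {\<omega>. \<forall>i<n. \<omega> i \<in> C i}"
  shows "M = N"
proof (rule measure_eqI_generator_eq[OF Int_stable_prod_algebra prod_algebra_sets_into_space])
  show "sets M = sigma_sets (\<Pi>\<^sub>E i\<in>UNIV. space borel) (prod_algebra UNIV (\<lambda>_. borel))"
    "sets N = sigma_sets (\<Pi>\<^sub>E i\<in>UNIV. space borel) (prod_algebra UNIV (\<lambda>_. borel))"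
    using assms(1,2) by (simp_all add: sets_PiM)
  show "emeasure M X = emeasure N X" if "X \<in> prod_algebra UNIV (\<lambda>_. borel)" for X
    using that by (rule prod_algebra_nat_box) (simp add: eq)
  have "prod_emb UNIV (\<lambda>_. borel) {0::nat} (\<Pi>\<^sub>E i\<in>{0}. UNIV :: 'a set) \<in> prod_algebra UNIV (\<lambda>_. borel)"
    by (rule prod_algebraI) auto
  moreover have "prod_emb UNIV (\<lambda>_. borel) {0::nat} (\<Pi>\<^sub>E i\<in>{0}. UNIV :: 'a set) = UNIV"
    by (subst prod_emb_Pi) (auto simp: PiE_iff)
  ultimately show "range (\<lambda>_::nat. UNIV) \<subseteq> prod_algebra UNIV (\<lambda>_::nat. borel :: 'a measure)"
    by simp
  show "(\<Union>i::nat. UNIV) = (\<Pi>\<^sub>E i\<in>UNIV::nat set. space (borel :: 'a measure))"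
    by auto
  show "emeasure M UNIV \<noteq> \<infinity>"
    using finite_measure.emeasure_finite[OF assms(3)] by simp
qed

abbreviation path_space :: "(nat \<Rightarrow> 'a::topological_space) measure" where
  "path_space \<equiv> PiM UNIV (\<lambda>_. borel)"

definition path_shift :: "(nat \<Rightarrow> 'a) \<Rightarrow> nat \<Rightarrow> 'a" where
  "path_shift \<omega> n = \<omega> (Suc n)"

lemma path_shift_measurable [measurable]: "path_shift \<in> path_space \<rightarrow>\<^sub>M path_space"
proof (rule measurable_PiM_single')
  show "(\<lambda>\<omega>. path_shift \<omega> i) \<in> path_space \<rightarrow>\<^sub>M borel" for i
    unfolding path_shift_def by measurable
qed (auto simp: space_PiM)

lemma box_measurable:
  assumes [measurable]: "\<And>i. C i \<in> sets borel"
  shows "{\<omega>. \<forall>i<n. \<omega> i \<in> C i} \<in> sets path_space"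
proof -
  have "{\<omega> \<in> space path_space. \<forall>i\<in>{..<n}. \<omega> i \<in> C i} \<in> sets path_space"
    by measurable
  then show ?thesis by (simp add: Ball_def space_PiM)
qed

lemma prob_space_return_borel: "prob_space (return borel x)" "sets (return borel x) = sets borel"
  by (simp_all add: prob_space_return)

lemma emeasure_chain_law_return_box:
  fixes P :: "'a::topological_space \<Rightarrow> 'a measure"
  assumes P: "transition_kernel P" and C: "\<And>i. C i \<in> sets borel"
  shows "emeasure (chain_law P (return borel x)) {\<omega>. \<forall>i<n. \<omega> i \<in> C i} = box_integral P n C (\<lambda>_. 1) x"
  unfolding emeasure_chain_law_box[where \<nu>="return borel x", OF P prob_space_return_borel C]
  by (rule nn_integral_return) (auto intro!: box_integral_measurable P C)

text \<open>The measurability that allows statements about every starting point, such as Harris recurrence,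
to be integrated against an initial distribution.\<close>

lemma chain_law_kernel:
  fixes P :: "'a::topological_space \<Rightarrow> 'a measure"
  assumes P: "transition_kernel P"
  shows "(\<lambda>x. chain_law P (return borel x)) \<in> borel \<rightarrow>\<^sub>M prob_algebra path_space"
proof (rule measurable_prob_algebra_generated[OF sets_PiM Int_stable_prod_algebra prod_algebra_sets_into_space])
  show "prob_space (chain_law P (return borel x))" for x
    by (rule prob_space_chain_law[OF P prob_space_return_borel])
  show "sets (chain_law P (return borel x)) = sets path_space" for x
    by (rule sets_chain_law[OF P prob_space_return_borel])
  show "(\<lambda>x. emeasure (chain_law P (return borel x)) X) \<in> borel_measurable borel"
    if "X \<in> prod_algebra UNIV (\<lambda>_. borel)" for X
    using that
  proof (rule prod_algebra_nat_box)
    fix n :: nat and C assume C: "\<And>i. C i \<in> sets borel" and X: "X = {\<omega>. \<forall>i<n. \<omega> i \<in> C i}"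
    show ?thesis
      unfolding X emeasure_chain_law_return_box[OF P C]
      by (rule box_integral_measurable[OF P _ C]) simp
  qed
qed

text \<open>Both sides give a box the integral of \<^const>\<open>box_integral\<close> over the initial distribution.\<close>

lemma chain_law_bind:
  fixes P :: "'a::topological_space \<Rightarrow> 'a measure"
  assumes P: "transition_kernel P" and \<nu>: "prob_space \<nu>" "sets \<nu> = sets borel"
  shows "chain_law P \<nu> = \<nu> \<bind> (\<lambda>x. chain_law P (return borel x))"
proof (rule measure_eqI_boxes)
  have \<nu>': "\<nu> \<in> space (prob_algebra borel)"
    using \<nu> by (simp add: space_prob_algebra)
  show "sets (chain_law P \<nu>) = sets path_space"
    by (rule sets_chain_law[OF P \<nu>])
  show "sets (\<nu> \<bind> (\<lambda>x. chain_law P (return borel x))) = sets path_space"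
    by (rule sets_bind'[OF \<nu>' chain_law_kernel[OF P]])
  show "finite_measure (chain_law P \<nu>)"
    using prob_space_chain_law[OF P \<nu>] by (simp add: prob_space_def)
  show "emeasure (chain_law P \<nu>) {\<omega>. \<forall>i<n. \<omega> i \<in> C i}
      = emeasure (\<nu> \<bind> (\<lambda>x. chain_law P (return borel x))) {\<omega>. \<forall>i<n. \<omega> i \<in> C i}"
    if C: "\<And>i. C i \<in> sets borel" for n C
    unfolding emeasure_bind_prob_algebra[OF \<nu>' chain_law_kernel[OF P] box_measurable[OF C]]
      emeasure_chain_law_return_box[OF P C]
    by (rule emeasure_chain_law_box[OF P \<nu> C])
qed

text \<open>The Markov property at time one. The shifted path lies in a box iff the path lies in the box
prefixed by an unconstrained coordinate, and the first-step recursion of \<^const>\<open>box_integral\<close>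
turns this prefix into an integral with respect to the kernel.\<close>

lemma distr_path_shift_chain_law:
  fixes P :: "'a::topological_space \<Rightarrow> 'a measure"
  assumes P: "transition_kernel P" and \<nu>: "prob_space \<nu>" "sets \<nu> = sets borel"
  shows "distr (chain_law P \<nu>) path_space path_shift = chain_law P (\<nu> \<bind> P)"
proof (rule measure_eqI_boxes)
  have \<nu>': "\<nu> \<in> space (prob_algebra borel)" and P': "P \<in> borel \<rightarrow>\<^sub>M prob_algebra borel"
    using P \<nu> by (simp_all add: space_prob_algebra transition_kernel_def)
  have \<nu>P: "prob_space (\<nu> \<bind> P)" "sets (\<nu> \<bind> P) = sets borel"
    using prob_space_bind'[OF \<nu>' P'] sets_bind'[OF \<nu>' P'] by auto
  have shift: "path_shift \<in> chain_law P \<nu> \<rightarrow>\<^sub>M path_space"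
    by (simp add: measurable_cong_sets[OF sets_chain_law[OF P \<nu>] refl])
  show "sets (distr (chain_law P \<nu>) path_space path_shift) = sets path_space" by simp
  show "sets (chain_law P (\<nu> \<bind> P)) = sets path_space"
    by (rule sets_chain_law[OF P \<nu>P])
  show "finite_measure (distr (chain_law P \<nu>) path_space path_shift)"
    using prob_space.prob_space_distr[OF prob_space_chain_law[OF P \<nu>] shift]
    by (simp add: prob_space_def)
  show "emeasure (distr (chain_law P \<nu>) path_space path_shift) {\<omega>. \<forall>i<n. \<omega> i \<in> C i}
      = emeasure (chain_law P (\<nu> \<bind> P)) {\<omega>. \<forall>i<n. \<omega> i \<in> C i}"
    if C: "\<And>i. C i \<in> sets borel" for n C
  proof -
    let ?C = "case_nat UNIV C"
    have C': "?C i \<in> sets borel" for i using C by (cases i) auto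
    have "path_shift -` {\<omega>. \<forall>i<n. \<omega> i \<in> C i} \<inter> space (chain_law P \<nu>) = {\<omega>. \<forall>i<Suc n. \<omega> i \<in> ?C i}"
      by (auto simp: space_chain_law[OF P \<nu>] path_shift_def less_Suc_eq_0_disj)
    then have "emeasure (distr (chain_law P \<nu>) path_space path_shift) {\<omega>. \<forall>i<n. \<omega> i \<in> C i}
        = emeasure (chain_law P \<nu>) {\<omega>. \<forall>i<Suc n. \<omega> i \<in> ?C i}"
      by (simp only: emeasure_distr[OF shift box_measurable[OF C]])
    also have "\<dots> = (\<integral>\<^sup>+x. (\<integral>\<^sup>+y. box_integral P n C (\<lambda>_. 1) y \<partial>P x) \<partial>\<nu>)"
      unfolding emeasure_chain_law_box[where C="?C", OF P \<nu> C'] by (intro nn_integral_cong) simp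
    also have "\<dots> = (\<integral>\<^sup>+y. box_integral P n C (\<lambda>_. 1) y \<partial>(\<nu> \<bind> P))"
      by (rule nn_integral_bind[symmetric, OF box_integral_measurable[OF P _ C]])
        (simp_all add: kernel_measurable[OF P] measurable_cong_sets[OF \<nu>(2) refl])
    also have "\<dots> = emeasure (chain_law P (\<nu> \<bind> P)) {\<omega>. \<forall>i<n. \<omega> i \<in> C i}"
      by (rule emeasure_chain_law_box[symmetric, OF P \<nu>P C])
    finally show ?thesis .
  qed
qed

section \<open>The stationary path measure\<close>

locale stationary_chain =
  fixes P :: "'a::topological_space \<Rightarrow> 'a measure" and \<mu> :: "'a measure"
  assumes kernel: "transition_kernel P" and stationary: "stationary P \<mu>"
begin

abbreviation M :: "(nat \<Rightarrow> 'a) measure" where "M \<equiv> chain_law P \<mu>"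

lemma prob_space_\<mu>: "prob_space \<mu>" and sets_\<mu> [measurable_cong]: "sets \<mu> = sets borel"
  using stationary by (auto simp: stationary_def)

lemma space_\<mu>: "space \<mu> = UNIV"
  using sets_eq_imp_space_eq[OF sets_\<mu>] by simp

lemma \<mu>_prob_algebra: "\<mu> \<in> space (prob_algebra borel)"
  using prob_space_\<mu> sets_\<mu> by (simp add: space_prob_algebra)

lemmas sets_M [measurable_cong] = sets_chain_law[OF kernel prob_space_\<mu> sets_\<mu>]
lemmas space_M [simp] = space_chain_law[OF kernel prob_space_\<mu> sets_\<mu>]

sublocale M: prob_space M
  by (rule prob_space_chain_law[OF kernel prob_space_\<mu> sets_\<mu>])

lemma bind_kernel: "\<mu> \<bind> P = \<mu>"
proof (rule measure_eqI)
  have P': "P \<in> borel \<rightarrow>\<^sub>M prob_algebra borel"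
    using kernel by (simp add: transition_kernel_def)
  show sets: "sets (\<mu> \<bind> P) = sets \<mu>"
    using sets_bind'[OF \<mu>_prob_algebra P'] sets_\<mu> by simp
  show "emeasure (\<mu> \<bind> P) C = emeasure \<mu> C" if "C \<in> sets (\<mu> \<bind> P)" for C
    using that sets sets_\<mu> stationary emeasure_bind_prob_algebra[OF \<mu>_prob_algebra P', of C]
    by (simp add: stationary_def)
qed

lemma distr_shift: "distr M path_space path_shift = M"
  using distr_path_shift_chain_law[OF kernel prob_space_\<mu> sets_\<mu>] by (simp add: bind_kernel)

lemma shift_measurable [measurable]: "path_shift \<in> M \<rightarrow>\<^sub>M path_space"
  by (simp add: measurable_cong_sets[OF sets_M refl])

lemma emeasure_shift:
  assumes "S \<in> sets path_space"
  shows "emeasure M {\<omega>. path_shift \<omega> \<in> S} = emeasure M S"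
proof -
  have "emeasure M S = emeasure (distr M path_space path_shift) S"
    by (simp only: distr_shift)
  also have "\<dots> = emeasure M {\<omega>. path_shift \<omega> \<in> S}"
    using assms by (simp add: emeasure_distr vimage_def)
  finally show ?thesis ..
qed

lemma emeasure_shift_iter:
  assumes S: "S \<in> sets path_space"
  shows "emeasure M {\<omega>. (\<lambda>k. \<omega> (n + k)) \<in> S} = emeasure M S"
proof (induction n)
  case (Suc n)
  have "{\<omega>. (\<lambda>k. \<omega> (n + k)) \<in> S} = (\<lambda>\<omega> k. \<omega> (n + k)) -` S \<inter> space path_space"
    by (auto simp: space_PiM)
  also have "\<dots> \<in> sets path_space"
    using S by (intro measurable_sets[OF _ S] measurable_PiM_single') (auto simp: space_PiM)
  finally show ?case
    using emeasure_shift[of "{\<omega>. (\<lambda>k. \<omega> (n + k)) \<in> S}"] Suc by (simp add: path_shift_def)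
qed (simp add: S)

lemma emeasure_coordinate:
  assumes "C \<in> sets borel"
  shows "emeasure M {\<omega>. \<omega> n \<in> C} = emeasure \<mu> C"
proof -
  have "emeasure M {\<omega>. \<forall>i<Suc 0. \<omega> i \<in> C} = (\<integral>\<^sup>+x. box_integral P (Suc 0) (\<lambda>_. C) (\<lambda>_. 1) x \<partial>\<mu>)"
    by (rule emeasure_chain_law_box[OF kernel prob_space_\<mu> sets_\<mu> assms])
  also have "\<dots> = (\<integral>\<^sup>+x. indicator C x \<partial>\<mu>)"
    by (intro nn_integral_cong)
      (simp add: prob_space.emeasure_space_1[OF kernel_prob_space(1)[OF kernel]])
  also have "\<dots> = emeasure \<mu> C"
    using assms by (simp add: sets_\<mu>)
  finally show ?thesis
    using emeasure_shift_iter[OF box_measurable[where C="\<lambda>_. C" and n="Suc 0", OF assms], of n] by simp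
qed

lemma AE_shift_iter:
  assumes "AE \<omega> in M. Q \<omega>"
  shows "AE \<omega> in M. \<forall>n. Q (\<lambda>k. \<omega> (n + k))"
  unfolding AE_all_countable
proof
  fix n
  obtain N where N: "{\<omega> \<in> space M. \<not> Q \<omega>} \<subseteq> N" "emeasure M N = 0" "N \<in> sets M"
    using assms by (rule AE_E)
  show "AE \<omega> in M. Q (\<lambda>k. \<omega> (n + k))"
  proof (rule AE_I)
    show "{\<omega> \<in> space M. \<not> Q (\<lambda>k. \<omega> (n + k))} \<subseteq> {\<omega>. (\<lambda>k. \<omega> (n + k)) \<in> N}"
      using N(1) by auto
    show "emeasure M {\<omega>. (\<lambda>k. \<omega> (n + k)) \<in> N} = 0"
      using N emeasure_shift_iter[of N n] sets_M by simp
    have "{\<omega>. (\<lambda>k. \<omega> (n + k)) \<in> N} = (\<lambda>\<omega> k. \<omega> (n + k)) -` N \<inter> space path_space"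
      by (auto simp: space_PiM)
    also have "\<dots> \<in> sets path_space"
      using N(3) sets_M
      by (intro measurable_sets[where A=path_space] measurable_PiM_single') (auto simp: space_PiM)
    finally show "{\<omega>. (\<lambda>k. \<omega> (n + k)) \<in> N} \<in> sets M" by (simp add: sets_M)
  qed
qed

lemma emeasure_two_steps:
  assumes C: "C \<in> sets borel" and D: "D \<in> sets borel"
  shows "emeasure M {\<omega>. \<omega> 0 \<in> C \<and> \<omega> 1 \<in> D} = (\<integral>\<^sup>+x. indicator C x * emeasure (P x) D \<partial>\<mu>)"
proof -
  let ?C = "\<lambda>i. if i = 0 then C else D"
  have C': "?C i \<in> sets borel" for i :: nat using C D by simp
  have "{\<omega>. \<omega> 0 \<in> C \<and> \<omega> 1 \<in> D} = {\<omega>. \<forall>i<Suc (Suc 0). \<omega> i \<in> ?C i}"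
    by (auto simp: less_Suc_eq)
  then have "emeasure M {\<omega>. \<omega> 0 \<in> C \<and> \<omega> 1 \<in> D}
      = (\<integral>\<^sup>+x. box_integral P (Suc (Suc 0)) ?C (\<lambda>_. 1) x \<partial>\<mu>)"
    by (simp only: emeasure_chain_law_box[where C="?C", OF kernel prob_space_\<mu> sets_\<mu> C'])
  also have "\<dots> = (\<integral>\<^sup>+x. indicator C x * emeasure (P x) D \<partial>\<mu>)"
    using D by (intro nn_integral_cong)
      (simp add: prob_space.emeasure_space_1[OF kernel_prob_space(1)[OF kernel]]
        kernel_prob_space(2)[OF kernel])
  finally show ?thesis .
qed

lemma Collect_in_sets_M: "Measurable.pred path_space Q \<Longrightarrow> {\<omega>. Q \<omega>} \<in> sets M"
  using sets_M by (simp add: pred_def space_PiM)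

section \<open>No set of stationary measure below one holds the chain forever\<close>

text \<open>If \<open>F\<close> cannot be entered from outside, then stationarity also forbids leaving it: \<open>X\<^sub>0 \<in> F\<close> and
\<open>X\<^sub>1 \<in> F\<close> have the same probability, so the flow out of \<open>F\<close> in one step equals the flow into \<open>F\<close>,
which is zero.\<close>

lemma absorbing_AE_invariant:
  assumes F: "F \<in> sets borel"
    and "AE x in \<mu>. x \<notin> F \<longrightarrow> emeasure (P x) F = 0"
  shows "AE \<omega> in M. \<forall>n. \<omega> n \<in> F \<longleftrightarrow> \<omega> 0 \<in> F"
proof -
  note F[measurable]
  have entry: "emeasure M {\<omega>. \<omega> 0 \<notin> F \<and> \<omega> 1 \<in> F} = 0"
  proof -
    have "emeasure M {\<omega>. \<omega> 0 \<in> - F \<and> \<omega> 1 \<in> F} = (\<integral>\<^sup>+x. indicator (- F) x * emeasure (P x) F \<partial>\<mu>)"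
      using F by (intro emeasure_two_steps) auto
    also have "\<dots> = (\<integral>\<^sup>+x. 0 \<partial>\<mu>)"
      using assms(2) by (intro nn_integral_cong_AE) (auto split: split_indicator)
    finally show ?thesis by simp
  qed
  have m: "{\<omega>. \<omega> 0 \<notin> F \<and> \<omega> 1 \<in> F} \<in> sets M" "{\<omega>. \<omega> 0 \<in> F \<and> \<omega> 1 \<notin> F} \<in> sets M"
    "{\<omega>. \<omega> 0 \<in> F \<and> \<omega> 1 \<in> F} \<in> sets M"
    by (intro Collect_in_sets_M; measurable)+
  have "emeasure \<mu> F = emeasure M {\<omega>. \<omega> 0 \<in> F}"
    by (rule emeasure_coordinate[OF F, symmetric])
  also have "{\<omega>. \<omega> 0 \<in> F} = {\<omega>. \<omega> 0 \<in> F \<and> \<omega> 1 \<in> F} \<union> {\<omega>. \<omega> 0 \<in> F \<and> \<omega> 1 \<notin> F}"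
    by auto
  also have "emeasure M \<dots> = emeasure M {\<omega>. \<omega> 0 \<in> F \<and> \<omega> 1 \<in> F} + emeasure M {\<omega>. \<omega> 0 \<in> F \<and> \<omega> 1 \<notin> F}"
    using m by (intro plus_emeasure[symmetric]) auto
  also have "emeasure M {\<omega>. \<omega> 0 \<in> F \<and> \<omega> 1 \<in> F}
      = emeasure M ({\<omega>. \<omega> 0 \<in> F \<and> \<omega> 1 \<in> F} \<union> {\<omega>. \<omega> 0 \<notin> F \<and> \<omega> 1 \<in> F})"
    using m entry by (subst plus_emeasure[symmetric]) auto
  also have "{\<omega>. \<omega> 0 \<in> F \<and> \<omega> 1 \<in> F} \<union> {\<omega>. \<omega> 0 \<notin> F \<and> \<omega> 1 \<in> F} = {\<omega>. \<omega> 1 \<in> F}"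
    by auto
  also have "emeasure M {\<omega>. \<omega> 1 \<in> F} = emeasure \<mu> F"
    by (rule emeasure_coordinate[OF F])
  finally have "emeasure \<mu> F + emeasure M {\<omega>. \<omega> 0 \<in> F \<and> \<omega> 1 \<notin> F} = emeasure \<mu> F + 0"
    by simp
  moreover have "emeasure \<mu> F \<noteq> \<infinity>"
    using M.emeasure_finite by (simp add: emeasure_coordinate[OF F, of 0, symmetric])
  ultimately have "emeasure M {\<omega>. \<omega> 0 \<in> F \<and> \<omega> 1 \<notin> F} = 0"
    by (simp only: ennreal_add_left_cancel simp_thms)
  then have "AE \<omega> in M. \<omega> 0 \<in> F \<longleftrightarrow> \<omega> 1 \<in> F"
    using entry m by (intro AE_I'[of "{\<omega>. \<omega> 0 \<notin> F \<and> \<omega> 1 \<in> F} \<union> {\<omega>. \<omega> 0 \<in> F \<and> \<omega> 1 \<notin> F}"]) (auto intro: null_setsI)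
  then have "AE \<omega> in M. \<forall>n. \<omega> (n + 0) \<in> F \<longleftrightarrow> \<omega> (n + 1) \<in> F"
    by (rule AE_shift_iter)
  then show ?thesis
  proof eventually_elim
    case (elim \<omega>)
    show ?case
    proof
      fix n show "\<omega> n \<in> F \<longleftrightarrow> \<omega> 0 \<in> F" using elim by (induction n) auto
    qed
  qed
qed

lemma AE_infinitely_often:
  assumes "\<And>x. AE \<omega> in chain_law P (return borel x). \<exists>\<^sub>\<infinity>n. \<omega> n \<in> C" and C: "C \<in> sets borel"
  shows "AE \<omega> in M. \<exists>\<^sub>\<infinity>n. \<omega> n \<in> C"
proof -
  note C[measurable]
  have K: "(\<lambda>x. chain_law P (return borel x)) \<in> \<mu> \<rightarrow>\<^sub>M subprob_algebra path_space"
    using measurable_prob_algebraD[OF chain_law_kernel[OF kernel]]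
    by (simp add: measurable_cong_sets[OF sets_\<mu> refl])
  have "Measurable.pred path_space (\<lambda>\<omega>. \<exists>\<^sub>\<infinity>n. \<omega> n \<in> C)"
    unfolding INFM_nat by measurable
  then show ?thesis
    using assms(1)
    by (subst chain_law_bind[OF kernel prob_space_\<mu> sets_\<mu>]) (simp add: AE_bind[OF K])
qed

text \<open>The consequence of Harris recurrence on which the theorem rests. The
set \<open>F\<close> of starting points from which \<open>A\<close> may hold the chain forever is almost surely never entered or
left, so a visit to \<open>F\<close> or to its complement, whichever is charged by the reference measure
\<open>\<phi>\<close>, determines where the chain started.\<close>

lemma AE_leaves:
  assumes Harris: "Harris_recurrent P" and A: "A \<in> sets borel" and "emeasure \<mu> (- A) \<noteq> 0"
  shows "AE \<omega> in M. \<exists>n. \<omega> n \<notin> A"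
proof -
  note A[measurable]
  define E where "E = {\<omega> :: nat \<Rightarrow> 'a. \<forall>n. \<omega> n \<in> A}"
  define L where "L x = chain_law P (return borel x)" for x
  define g where "g x = emeasure (L x) E" for x
  define F where "F = {x. g x \<noteq> 0}"
  have E: "E \<in> sets path_space"
  proof -
    have "{\<omega> \<in> space path_space. \<forall>n. \<omega> n \<in> A} \<in> sets path_space" by measurable
    then show ?thesis by (simp add: E_def space_PiM)
  qed
  have L: "L \<in> borel \<rightarrow>\<^sub>M prob_algebra path_space"
    unfolding L_def[abs_def] by (rule chain_law_kernel[OF kernel])
  have g[measurable]: "g \<in> borel_measurable borel"
    unfolding g_def[abs_def]
    by (rule measurable_compose[OF measurable_prob_algebraD[OF L]])
      (rule measurable_emeasure_subprob_algebra[OF E])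
  have mix: "emeasure (chain_law P \<nu>) E = (\<integral>\<^sup>+x. g x \<partial>\<nu>)"
    if "prob_space \<nu>" "sets \<nu> = sets borel" for \<nu>
    unfolding chain_law_bind[OF kernel that] g_def L_def
    using that by (intro emeasure_bind_prob_algebra[OF _ chain_law_kernel[OF kernel] E])
      (simp add: space_prob_algebra)
  note ME = mix[OF prob_space_\<mu> sets_\<mu>]
  have F[measurable]: "F \<in> sets borel"
    unfolding F_def by measurable
  \<comment> \<open>A path that stays in \<open>A\<close> still does so after its first point is deleted.\<close>
  have sub: "g x \<le> (\<integral>\<^sup>+y. g y \<partial>P x)" for x
  proof -
    note r = kernel prob_space_return_borel(1)[of x] prob_space_return_borel(2)[of x]
    have shift: "path_shift \<in> L x \<rightarrow>\<^sub>M path_space"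
      unfolding L_def by (simp add: measurable_cong_sets[OF sets_chain_law[OF r] refl])
    have "g x \<le> emeasure (L x) (path_shift -` E \<inter> space (L x))"
      unfolding g_def using space_chain_law[OF r]
      by (intro emeasure_mono measurable_sets[OF shift E]) (auto simp: E_def path_shift_def L_def)
    also have "\<dots> = emeasure (distr (L x) path_space path_shift) E"
      by (rule emeasure_distr[OF shift E, symmetric])
    also have "\<dots> = emeasure (chain_law P (P x)) E"
      unfolding L_def distr_path_shift_chain_law[OF r]
      by (simp add: bind_return[OF kernel_measurable[OF kernel]])
    also have "\<dots> = (\<integral>\<^sup>+y. g y \<partial>P x)"
      by (rule mix[OF kernel_prob_space[OF kernel]])
    finally show ?thesis .
  qed
  have Pg[measurable]: "(\<lambda>x. \<integral>\<^sup>+y. g y \<partial>P x) \<in> borel_measurable borel"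
    by (rule measurable_compose[OF kernel_measurable[OF kernel]])
      (rule nn_integral_measurable_subprob_algebra[OF g])
  have K\<mu>: "P \<in> \<mu> \<rightarrow>\<^sub>M subprob_algebra borel"
    by (simp add: measurable_cong_sets[OF sets_\<mu> refl] kernel_measurable[OF kernel])
  \<comment> \<open>Equal finite integrals force the pointwise inequality between \<open>g\<close> and \<open>P g\<close> to be an equality
    almost everywhere.\<close>
  have eq: "(\<integral>\<^sup>+x. (\<integral>\<^sup>+y. g y \<partial>P x) \<partial>\<mu>) = (\<integral>\<^sup>+x. g x \<partial>\<mu>)"
    using nn_integral_bind[OF g K\<mu>] by (simp add: bind_kernel)
  have fin: "(\<integral>\<^sup>+x. g x \<partial>\<mu>) \<noteq> \<infinity>"
    unfolding ME[symmetric] by simp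
  have "(\<integral>\<^sup>+x. (\<integral>\<^sup>+y. g y \<partial>P x) - g x \<partial>\<mu>) = 0"
    using sub fin eq by (subst nn_integral_diff) (auto simp: diff_eq_0_iff_ennreal)
  then have "AE x in \<mu>. (\<integral>\<^sup>+y. g y \<partial>P x) - g x = 0"
    by (subst (asm) nn_integral_0_iff_AE) auto
  then have closed: "AE x in \<mu>. x \<notin> F \<longrightarrow> emeasure (P x) F = 0"
  proof eventually_elim
    case (elim x)
    show ?case
    proof
      assume "x \<notin> F"
      then have "(\<integral>\<^sup>+y. g y \<partial>P x) = 0" using elim by (simp add: F_def)
      moreover have "g \<in> borel_measurable (P x)"
        by (simp add: measurable_cong_sets[OF kernel_prob_space(2)[OF kernel] refl])
      ultimately have "emeasure (P x) {y \<in> space (P x). g y \<noteq> 0} = 0"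
        by (simp add: nn_integral_0_iff)
      moreover have "space (P x) = UNIV"
        using sets_eq_imp_space_eq[OF kernel_prob_space(2)[OF kernel]] by simp
      ultimately show "emeasure (P x) F = 0" by (simp add: F_def)
    qed
  qed
  have inv: "AE \<omega> in M. \<forall>n. \<omega> n \<in> F \<longleftrightarrow> \<omega> 0 \<in> F"
    by (rule absorbing_AE_invariant[OF F closed])
  have FA: "F \<subseteq> A"
  proof
    fix x assume "x \<in> F"
    note r = kernel prob_space_return_borel(1)[of x] prob_space_return_borel(2)[of x]
    have "g x \<le> emeasure (L x) {\<omega>. \<forall>i<Suc 0. \<omega> i \<in> (\<lambda>_. A) i}"
      unfolding g_def L_def E_def using box_measurable[of "\<lambda>_. A" "Suc 0"] sets_chain_law[OF r]
      by (intro emeasure_mono) auto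
    also have "\<dots> = indicator A x"
      unfolding L_def using A
      by (subst emeasure_chain_law_return_box[OF kernel])
        (auto simp: prob_space.emeasure_space_1[OF kernel_prob_space(1)[OF kernel]])
    finally show "x \<in> A"
      using \<open>x \<in> F\<close> by (auto simp: F_def split: split_indicator_asm)
  qed
  obtain \<phi> where \<phi>: "sets \<phi> = sets borel" "emeasure \<phi> (space \<phi>) \<noteq> 0"
    and rec: "\<And>C x. C \<in> sets borel \<Longrightarrow> emeasure \<phi> C > 0 \<Longrightarrow>
      AE \<omega> in chain_law P (return borel x). \<exists>\<^sub>\<infinity>n. \<omega> n \<in> C"
    using Harris unfolding Harris_recurrent_def by metis
  have "space \<phi> = F \<union> - F"
    using sets_eq_imp_space_eq[OF \<phi>(1)] by simp
  then have "emeasure \<phi> F > 0 \<or> emeasure \<phi> (- F) > 0"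
    using \<phi> emeasure_subadditive[of F \<phi> "- F"] by (auto simp: zero_less_iff_neq_zero)
  then have "AE \<omega> in M. \<omega> 0 \<notin> F"
  proof
    \<comment> \<open>In this case \<open>\<mu>\<close> would be concentrated on \<open>F\<close>, hence on \<open>A\<close>, which is excluded.\<close>
    assume "emeasure \<phi> F > 0"
    then have "AE \<omega> in M. \<exists>\<^sub>\<infinity>n. \<omega> n \<in> F"
      by (intro AE_infinitely_often rec F)
    then have "AE \<omega> in M. \<omega> 0 \<in> F"
      using inv by eventually_elim (auto dest: INFM_EX)
    then have "AE \<omega> in M. \<omega> 0 \<notin> - A"
      by eventually_elim (use FA in auto)
    moreover have "{\<omega>. \<omega> 0 \<in> - A} \<in> sets M"
      by (rule Collect_in_sets_M) measurable
    ultimately have "emeasure M {\<omega>. \<omega> 0 \<in> - A} = 0"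
      by (subst (asm) AE_iff_measurable[where N="{\<omega>. \<omega> 0 \<in> - A}"]) auto
    with assms(3) show ?thesis
      using emeasure_coordinate[of "- A" 0] A by simp
  next
    assume "emeasure \<phi> (- F) > 0"
    then have "AE \<omega> in M. \<exists>\<^sub>\<infinity>n. \<omega> n \<in> - F"
      using F by (intro AE_infinitely_often rec) auto
    then show ?thesis
      using inv by eventually_elim (auto dest: INFM_EX)
  qed
  moreover have "{\<omega>. \<omega> 0 \<in> F} \<in> sets M"
    by (rule Collect_in_sets_M) measurable
  ultimately have "emeasure \<mu> F = 0"
    using emeasure_coordinate[OF F, of 0]
    by (subst (asm) AE_iff_measurable[where N="{\<omega>. \<omega> 0 \<in> F}"]) auto
  then have "AE x in \<mu>. x \<notin> F"
    using sets_\<mu> F by (intro AE_I'[of F]) (auto intro: null_setsI)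
  then have "AE x in \<mu>. g x = 0"
    by eventually_elim (simp add: F_def)
  then have "emeasure M E = 0"
    unfolding ME by (subst nn_integral_0_iff_AE) auto
  then show ?thesis
    using E sets_M by (intro AE_I'[of E]) (auto simp: E_def intro: null_setsI)
qed

end

section \<open>The first cycle in terms of crossings\<close>

definition crosses :: "'a set \<Rightarrow> (nat \<Rightarrow> 'a) \<Rightarrow> nat \<Rightarrow> bool" where
  "crosses A \<omega> k \<longleftrightarrow> \<omega> k \<notin> A \<and> \<omega> (Suc k) \<in> A"

lemma crosses_between:
  assumes "\<omega> n \<notin> A" "\<omega> (n + k) \<in> A"
  shows "\<exists>i. crosses A \<omega> i"
proof (rule ccontr)
  assume no: "\<not> ?thesis"
  have "\<omega> (n + j) \<notin> A" for j
    using assms(1) no by (induction j) (auto simp: crosses_def)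
  with assms(2) show False by blast
qed

text \<open>For \<open>s = \<infinity>\<close> both sides are infinite, so a path without a further crossing needs no special
treatment when the cycle length is expressed as an occupation time.\<close>

lemma suminf_enat_interval:
  "(\<Sum>n. if enat m \<le> enat n \<and> enat n < s then 1 else 0) = ennreal_of_enat (s - enat m)"
proof -
  let ?X = "{n. enat m \<le> enat n \<and> enat n < s}"
  have "(\<Sum>n. if enat m \<le> enat n \<and> enat n < s then 1 else 0) = (\<Sum>n. indicator ?X n :: ennreal)"
    by (intro suminf_cong) (simp add: indicator_def)
  also have "\<dots> = emeasure (count_space UNIV) ?X"
    by (simp flip: nn_integral_count_space_nat)
  also have "\<dots> = ennreal_of_enat (s - enat m)"
  proof (cases s)
    case (enat t)
    then have "?X = {m..<t}" by auto
    then show ?thesis by (simp add: enat ennreal_of_nat_eq_real_of_nat)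
  next
    case infinity
    then have "?X = {m..}" by auto
    moreover have "infinite {m..}" by (rule infinite_Ici)
    ultimately show ?thesis by (simp add: infinity emeasure_count_space_infinite)
  qed
  finally show ?thesis .
qed

lemma cycle_start_1:
  assumes "\<omega> \<in> crossing_event A"
  shows "cycle_start A \<omega> 1 = enat 1"
proof -
  have "cycle_start A \<omega> 1 = Inf {enat n |n. enat n > 0 \<and> \<omega> (n - 1) \<notin> A \<and> \<omega> n \<in> A}"
    by simp
  also have "\<dots> = enat 1"
  proof (rule Inf_eqI)
    show "enat 1 \<le> i" if "i \<in> {enat n |n. enat n > 0 \<and> \<omega> (n - 1) \<notin> A \<and> \<omega> n \<in> A}" for i
      using that by (auto simp: zero_enat_def)
    show "y \<le> enat 1" if "\<And>i. i \<in> {enat n |n. enat n > 0 \<and> \<omega> (n - 1) \<notin> A \<and> \<omega> n \<in> A} \<Longrightarrow> y \<le> i" for y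
      using assms by (intro that) (auto simp: crossing_event_def zero_enat_def)
  qed
  finally show ?thesis .
qed

text \<open>The inward crossing at time \<open>k + 1\<close> is recorded by \<^const>\<open>crosses\<close> at its left end point \<open>k\<close>.
The second crossing time is thus later than \<open>j + 1\<close> iff there is no crossing with left end point in
\<open>{1..j}\<close>.\<close>

lemma before_next_crossing:
  assumes "\<omega> \<in> crossing_event A"
  shows "enat (Suc j) < crossing_time A \<omega> 1 \<longleftrightarrow> (\<forall>k<j. \<not> crosses A \<omega> (Suc k))"
proof -
  let ?T = "{enat n |n. enat n > enat 1 \<and> \<omega> (n - 1) \<notin> A \<and> \<omega> n \<in> A}"
  have T: "crossing_time A \<omega> 1 = Inf ?T"
    unfolding crossing_time_def cycle_start.simps(2)[of _ _ 1] cycle_start_1[OF assms] ..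
  show ?thesis
  proof
    assume less: "enat (Suc j) < crossing_time A \<omega> 1"
    show "\<forall>k<j. \<not> crosses A \<omega> (Suc k)"
    proof (intro allI impI notI)
      fix k assume "k < j" "crosses A \<omega> (Suc k)"
      then have "Inf ?T \<le> enat (Suc (Suc k))"
        by (intro Inf_lower) (auto simp: crosses_def)
      with less \<open>k < j\<close> show False unfolding T by (auto dest: less_le_trans)
    qed
  next
    assume no: "\<forall>k<j. \<not> crosses A \<omega> (Suc k)"
    have "enat (Suc (Suc j)) \<le> Inf ?T"
    proof (rule Inf_greatest)
      fix i assume "i \<in> ?T"
      then obtain n where n: "i = enat n" "n > 1" "\<omega> (n - 1) \<notin> A" "\<omega> n \<in> A" by auto
      then obtain k where k: "n = Suc (Suc k)" by (metis One_nat_def Suc_lessE less_imp_Suc_add add_0)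
      with n no have "\<not> k < j" by (auto simp: crosses_def)
      with n k show "enat (Suc (Suc j)) \<le> i" by simp
    qed
    moreover have "enat (Suc j) < enat (Suc (Suc j))" by simp
    ultimately show "enat (Suc j) < crossing_time A \<omega> 1"
      unfolding T by (rule less_le_trans[rotated])
  qed
qed

text \<open>The event that the first cycle starts at time \<open>1\<close> and that at time \<open>n\<close> it is still running and the chain is in \<open>B\<close>. It is
empty for \<open>n = 0\<close>, because time \<open>0\<close> precedes the cycle.\<close>

fun cycle_visit :: "'a set \<Rightarrow> 'a set \<Rightarrow> nat \<Rightarrow> (nat \<Rightarrow> 'a) set" where
  "cycle_visit A B 0 = {}"
| "cycle_visit A B (Suc j) =
     {\<omega>. crosses A \<omega> 0 \<and> (\<forall>k<j. \<not> crosses A \<omega> (Suc k)) \<and> \<omega> (Suc j) \<in> B}"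

lemma cycle_occupation_1:
  assumes "\<omega> \<in> crossing_event A"
  shows "cycle_occupation A B \<omega> 1 = (\<Sum>n. indicator (cycle_visit A B n) \<omega>)"
  unfolding cycle_occupation_def
proof (rule suminf_cong)
  fix n
  have "crosses A \<omega> 0"
    using assms by (simp add: crosses_def crossing_event_def)
  then show "(if cycle_start A \<omega> 1 \<le> enat n \<and> enat n < crossing_time A \<omega> 1 then indicator B (\<omega> n) else 0)
      = (indicator (cycle_visit A B n) \<omega> :: ennreal)"
    unfolding cycle_start_1[OF assms]
    by (cases n) (auto simp: before_next_crossing[OF assms, unfolded One_nat_def] split: split_indicator)
qed

lemma cycle_length_1:
  assumes "\<omega> \<in> crossing_event A"
  shows "ennreal_of_enat (cycle_length A \<omega> 1) = cycle_occupation A UNIV \<omega> 1"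
  unfolding cycle_length_def cycle_occupation_def cycle_start_1[OF assms]
    suminf_enat_interval[symmetric]
  by (simp del: One_nat_def cong: if_cong)

definition no_crossing_yet :: "'a set \<Rightarrow> 'a set \<Rightarrow> nat \<Rightarrow> (nat \<Rightarrow> 'a) set" where
  "no_crossing_yet A B N = {\<omega>. (\<forall>k<N. \<not> crosses A \<omega> k) \<and> \<omega> N \<in> B}"

section \<open>Occupation of the first cycle in the stationary regime\<close>

context stationary_chain
begin

lemma pred_crosses [measurable]:
  assumes [measurable]: "A \<in> sets borel"
  shows "Measurable.pred path_space (\<lambda>\<omega>. crosses A \<omega> k)"
  unfolding crosses_def by measurable

lemma no_crossing_yet_sets:
  assumes [measurable]: "A \<in> sets borel" "B \<in> sets borel"
  shows "no_crossing_yet A B N \<in> sets M"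
proof -
  have "Measurable.pred path_space (\<lambda>\<omega>. (\<forall>k\<in>{..<N}. \<not> crosses A \<omega> k) \<and> \<omega> N \<in> B)"
    by measurable
  from Collect_in_sets_M[OF this] show ?thesis
    by (simp add: no_crossing_yet_def Ball_def)
qed

lemma cycle_visit_sets:
  assumes [measurable]: "A \<in> sets borel" "B \<in> sets borel"
  shows "cycle_visit A B n \<in> sets M"
proof (cases n)
  case (Suc j)
  have "Measurable.pred path_space
      (\<lambda>\<omega>. crosses A \<omega> 0 \<and> (\<forall>k\<in>{..<j}. \<not> crosses A \<omega> (Suc k)) \<and> \<omega> (Suc j) \<in> B)"
    by measurable
  from Collect_in_sets_M[OF this] show ?thesis
    by (simp add: Suc Ball_def)
qed simp

lemma crossing_event_sets:
  assumes [measurable]: "A \<in> sets borel"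
  shows "crossing_event A \<in> sets M"
  unfolding crossing_event_def by (rule Collect_in_sets_M) measurable

text \<open>The two events on the left differ in whether there is a crossing at \<open>0\<close>. Their disjoint union does not
constrain the crossing at \<open>0\<close> and is therefore the preimage under the shift of the event on the
right.\<close>

lemma cycle_visit_telescope:
  assumes A: "A \<in> sets borel" and B: "B \<in> sets borel"
  shows "emeasure M (cycle_visit A B (Suc j)) + emeasure M (no_crossing_yet A B (Suc j))
    = emeasure M (no_crossing_yet A B j)"
proof -
  have "emeasure M (cycle_visit A B (Suc j)) + emeasure M (no_crossing_yet A B (Suc j))
      = emeasure M (cycle_visit A B (Suc j) \<union> no_crossing_yet A B (Suc j))"
    by (rule plus_emeasure[OF cycle_visit_sets[OF A B] no_crossing_yet_sets[OF A B]])
      (auto simp: no_crossing_yet_def)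
  also have "cycle_visit A B (Suc j) \<union> no_crossing_yet A B (Suc j)
      = {\<omega>. path_shift \<omega> \<in> no_crossing_yet A B j}"
    by (auto simp: no_crossing_yet_def path_shift_def crosses_def less_Suc_eq_0_disj)
  also have "emeasure M \<dots> = emeasure M (no_crossing_yet A B j)"
    using no_crossing_yet_sets[OF A B] sets_M by (intro emeasure_shift) simp
  finally show ?thesis .
qed

lemma sum_cycle_visits:
  assumes A: "A \<in> sets borel" and B: "B \<in> sets borel"
  shows "(\<Sum>n<Suc N. emeasure M (cycle_visit A B n)) + emeasure M (no_crossing_yet A B N) = emeasure \<mu> B"
proof (induction N)
  case 0
  show ?case by (simp add: no_crossing_yet_def emeasure_coordinate[OF B])
next
  case (Suc N)
  then show ?case
    by (simp only: sum.lessThan_Suc[of _ "Suc N"] add.assoc cycle_visit_telescope[OF A B])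
qed

text \<open>Almost surely the path is outside \<open>A\<close> at some time and inside \<open>A\<close> at some later time.\<close>

lemma AE_crosses:
  assumes Harris: "Harris_recurrent P" and A: "A \<in> sets borel"
    and "emeasure \<mu> A \<noteq> 0" "emeasure \<mu> (- A) \<noteq> 0"
  shows "AE \<omega> in M. \<exists>k. crosses A \<omega> k"
proof -
  have "AE \<omega> in M. \<exists>n. \<omega> n \<notin> A"
    using Harris A assms(4) by (rule AE_leaves)
  moreover have "AE \<omega> in M. \<exists>n. \<omega> n \<notin> - A"
    using A assms(3) by (intro AE_leaves[OF Harris]) auto
  then have "AE \<omega> in M. \<forall>n. \<exists>k. \<omega> (n + k) \<notin> - A"
    by (rule AE_shift_iter)
  ultimately show ?thesis
    by eventually_elim (auto intro: crosses_between)
qed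

lemma no_crossing_yet_tendsto_0:
  assumes A: "A \<in> sets borel" and B: "B \<in> sets borel"
    and cross: "AE \<omega> in M. \<exists>k. crosses A \<omega> k"
  shows "(\<lambda>N. emeasure M (no_crossing_yet A B N)) \<longlonglongrightarrow> 0"
proof (rule tendsto_sandwich[OF _ _ tendsto_const])
  let ?N = "no_crossing_yet A UNIV"
  have m: "range ?N \<subseteq> sets M"
    using no_crossing_yet_sets[OF A, of UNIV] by auto
  have "(\<Inter>N. ?N N) = {\<omega>. \<forall>k. \<not> crosses A \<omega> k}"
    by (auto simp: no_crossing_yet_def)
  moreover have "emeasure M (\<Inter>N. ?N N) = 0"
  proof -
    have "(\<Inter>N. ?N N) \<in> sets M"
      using m by (intro sets.countable_INT) auto
    then show ?thesis
      using cross calculation by (subst (asm) AE_iff_measurable[where N="\<Inter>N. ?N N"]) auto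
  qed
  moreover have "(\<lambda>N. emeasure M (?N N)) \<longlonglongrightarrow> emeasure M (\<Inter>N. ?N N)"
    by (intro Lim_emeasure_decseq m) (auto simp: decseq_def no_crossing_yet_def)
  ultimately show "(\<lambda>N. emeasure M (?N N)) \<longlonglongrightarrow> 0" by simp
  show "\<forall>\<^sub>F N in sequentially. emeasure M (no_crossing_yet A B N) \<le> emeasure M (?N N)"
    using m by (intro always_eventually allI emeasure_mono) (auto simp: no_crossing_yet_def)
qed auto

lemma suminf_cycle_visits:
  assumes A: "A \<in> sets borel" and B: "B \<in> sets borel"
    and cross: "AE \<omega> in M. \<exists>k. crosses A \<omega> k"
  shows "(\<Sum>n. emeasure M (cycle_visit A B n)) = emeasure \<mu> B"
proof -
  let ?S = "\<lambda>N. \<Sum>n<N. emeasure M (cycle_visit A B n)"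
  have "?S \<longlonglongrightarrow> (\<Sum>n. emeasure M (cycle_visit A B n))"
    by (rule summable_LIMSEQ) simp
  then have "(\<lambda>N. ?S (Suc N) + emeasure M (no_crossing_yet A B N))
      \<longlonglongrightarrow> (\<Sum>n. emeasure M (cycle_visit A B n)) + 0"
    by (intro tendsto_add LIMSEQ_Suc no_crossing_yet_tendsto_0 assms)
  then show ?thesis
    unfolding sum_cycle_visits[OF A B] by (simp add: LIMSEQ_const_iff)
qed

text \<open>By shift invariance a crossing at any given time has probability \<open>\<alpha>\<^sub>A\<close>, so if this
were zero, almost no path would cross at all.\<close>

lemma crossing_prob_pos:
  assumes A: "A \<in> sets borel" and cross: "AE \<omega> in M. \<exists>k. crosses A \<omega> k"
  shows "crossing_prob P \<mu> A \<noteq> 0"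
proof
  assume "crossing_prob P \<mu> A = 0"
  then have "AE \<omega> in M. \<not> crosses A \<omega> 0"
    using crossing_event_sets[OF A]
    by (intro AE_I'[of "crossing_event A"])
      (auto simp: crossing_prob_def crossing_event_def crosses_def intro: null_setsI)
  then have "AE \<omega> in M. \<forall>n. \<not> crosses A (\<lambda>k. \<omega> (n + k)) 0"
    by (rule AE_shift_iter)
  with cross have "AE \<omega> in M. False"
    by eventually_elim (auto simp: crosses_def)
  then show False
    by simp
qed

lemma AE_cycle_stationary:
  assumes A: "A \<in> sets borel"
  shows "AE \<omega> in cycle_stationary_law P \<mu> A. \<omega> \<in> crossing_event A"
  unfolding cycle_stationary_law_def
  by (rule AE_uniform_measureI[OF crossing_event_sets[OF A]]) simp

lemma mean_cycle_occupation_eq: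
  assumes A: "A \<in> sets borel" and B: "B \<in> sets borel"
    and cross: "AE \<omega> in M. \<exists>k. crosses A \<omega> k"
  shows "mean_cycle_occupation P \<mu> A B = emeasure \<mu> B / crossing_prob P \<mu> A"
proof -
  note [measurable] = cycle_visit_sets[OF A B]
  have sub: "cycle_visit A B n \<subseteq> crossing_event A" for n
    by (cases n) (auto simp: crossing_event_def crosses_def)
  have outside: "(\<Sum>n. indicator (cycle_visit A B n) \<omega>) = (0 :: ennreal)" if "\<omega> \<notin> crossing_event A" for \<omega>
  proof -
    have "indicator (cycle_visit A B n) \<omega> = (0 :: ennreal)" for n
      using sub that by (auto simp: indicator_def)
    then show ?thesis by simp
  qed
  have "mean_cycle_occupation P \<mu> A B
      = (\<integral>\<^sup>+\<omega>. (\<Sum>n. indicator (cycle_visit A B n) \<omega>) \<partial>cycle_stationary_law P \<mu> A)"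
    unfolding mean_cycle_occupation_def
    using AE_cycle_stationary[OF A]
    by (intro nn_integral_cong_AE) (elim eventually_mono, rule cycle_occupation_1)
  also have "\<dots> = (\<integral>\<^sup>+\<omega>. (\<Sum>n. indicator (cycle_visit A B n) \<omega>) * indicator (crossing_event A) \<omega> \<partial>M)
      / emeasure M (crossing_event A)"
    unfolding cycle_stationary_law_def
    by (rule nn_integral_uniform_measure[OF _ crossing_event_sets[OF A]]) measurable
  also have "(\<integral>\<^sup>+\<omega>. (\<Sum>n. indicator (cycle_visit A B n) \<omega>) * indicator (crossing_event A) \<omega> \<partial>M)
      = (\<integral>\<^sup>+\<omega>. (\<Sum>n. indicator (cycle_visit A B n) \<omega>) \<partial>M)"
    by (intro nn_integral_cong) (auto simp: outside indicator_def[of "crossing_event A"])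
  also have "\<dots> = (\<Sum>n. emeasure M (cycle_visit A B n))"
    by (subst nn_integral_suminf) auto
  also have "\<dots> = emeasure \<mu> B"
    by (rule suminf_cycle_visits[OF A B cross])
  finally show ?thesis
    by (simp only: crossing_prob_def)
qed

lemma mean_cycle_length_eq:
  assumes A: "A \<in> sets borel" and cross: "AE \<omega> in M. \<exists>k. crosses A \<omega> k"
  shows "mean_cycle_length P \<mu> A = inverse (crossing_prob P \<mu> A)"
proof -
  have "mean_cycle_length P \<mu> A = mean_cycle_occupation P \<mu> A UNIV"
    unfolding mean_cycle_length_def mean_cycle_occupation_def
    using AE_cycle_stationary[OF A]
    by (intro nn_integral_cong_AE) (elim eventually_mono, rule cycle_length_1)
  also have "\<dots> = 1 / crossing_prob P \<mu> A"
    using prob_space.emeasure_space_1[OF prob_space_\<mu>]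
    by (simp add: mean_cycle_occupation_eq[OF A _ cross] space_\<mu>)
  finally show ?thesis
    by (simp add: divide_ennreal_def)
qed

end

theorem theorem1:
  fixes P :: "real ^ 'd \<Rightarrow> (real ^ 'd) measure"
    and \<mu> :: "(real ^ 'd) measure"
    and A B :: "(real ^ 'd) set"
  assumes "transition_kernel P"
    and "positive_Harris_recurrent P"
    and "stationary P \<mu>"
    and "A \<in> sets borel" and "B \<in> sets borel"
    and "0 < measure \<mu> A" and "measure \<mu> A < 1"
  shows "mean_cycle_length P \<mu> A < \<infinity>
    \<and> emeasure \<mu> B = crossing_prob P \<mu> A * mean_cycle_occupation P \<mu> A B
    \<and> crossing_prob P \<mu> A = inverse (mean_cycle_length P \<mu> A)"
proof -
  interpret stationary_chain P \<mu>
    using assms(1,3) by (rule stationary_chain.intro)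
  interpret \<mu>: prob_space \<mu> by (rule prob_space_\<mu>)
  let ?\<alpha> = "crossing_prob P \<mu> A"
  have "\<mu>.prob (- A) = 1 - \<mu>.prob A"
    using \<mu>.prob_compl[of A] assms(4) by (simp add: sets_\<mu> space_\<mu> Compl_eq_Diff_UNIV)
  then have cross: "AE \<omega> in M. \<exists>k. crosses A \<omega> k"
    using assms(2,4,6,7)
    by (intro AE_crosses) (auto simp: positive_Harris_recurrent_def \<mu>.emeasure_eq_measure)
  have \<alpha>: "?\<alpha> \<noteq> 0" "?\<alpha> \<noteq> \<infinity>"
    using crossing_prob_pos[OF assms(4) cross] by (simp_all add: crossing_prob_def)
  have "mean_cycle_length P \<mu> A = inverse ?\<alpha>"
    by (rule mean_cycle_length_eq[OF assms(4) cross])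
  moreover have "inverse ?\<alpha> < \<infinity>"
    using \<alpha>(1) by (simp add: less_top[symmetric])
  moreover have "emeasure \<mu> B = ?\<alpha> * mean_cycle_occupation P \<mu> A B"
    using \<alpha> unfolding mean_cycle_occupation_eq[OF assms(4,5) cross]
    by (simp add: ennreal_times_divide mult.commute[of ?\<alpha>] ennreal_mult_divide_eq)
  moreover have "inverse (inverse ?\<alpha>) = ?\<alpha>"
    using \<alpha> by (cases ?\<alpha>) (auto simp: inverse_ennreal)
  ultimately show ?thesis by simp
qed

end
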